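(* Let $d$ be a strictly convex distance function on $\mathbb{R}^2$, and let $S\subset\mathbb{R}^2$ be a set of points such that $d(p,q)$ is an integer for all $p,q\in S$. Then $S$ is finite or collinear (contained in a line).
   Context: A convex distance function on $\mathbb{R}^2$ is defined from a centrally symmetric (about the origin) compact convex body $K\subset\mathbb{R}^2$ (with nonempty interior): $d_K(p,q)$ is the smallest scale factor $s\ge 0$ such that the copy of $K$ scaled by $s$ and centered at $p$ contains $q$, i.e. $q\in p+sK$. Equivalently $d_K(p,q)=\|q-p\|_K$ for the norm with closed unit ball $K$. The distance function is strictly convex if $K$ is strictly convex, i.e. the boundary of $K$ contains no (nondegenerate) line segment. *)

theory Defs
  imports "HOL-Analysis.Analysis"
begin

definition symmetric_convex_body :: "(real ^ 2) set \<Rightarrow> bool" where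
  "symmetric_convex_body K \<longleftrightarrow>
     compact K \<and> convex K \<and> interior K \<noteq> {} \<and> (\<forall>x\<in>K. - x \<in> K)"

definition strictly_convex_body :: "(real ^ 2) set \<Rightarrow> bool" where
  "strictly_convex_body K \<longleftrightarrow>
     (\<forall>a b. a \<noteq> b \<longrightarrow> \<not> closed_segment a b \<subseteq> frontier K)"

(* LEAST is over the reals; lemma convex_dist_least below shows that the minimum is attained
   whenever K is a symmetric convex body. *)
definition convex_dist :: "(real ^ 2) set \<Rightarrow> real ^ 2 \<Rightarrow> real ^ 2 \<Rightarrow> real" where
  "convex_dist K p q = (LEAST s. 0 \<le> s \<and> q \<in> (\<lambda>x. p + s *\<^sub>R x) ` K)"

definition strictly_convex_distance :: "(real ^ 2 \<Rightarrow> real ^ 2 \<Rightarrow> real) \<Rightarrow> bool" where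
  "strictly_convex_distance d \<longleftrightarrow>
     (\<exists>K. symmetric_convex_body K \<and> strictly_convex_body K \<and> d = convex_dist K)"

lemma symmetric_convex_body_zero_interior:
  assumes "symmetric_convex_body K"
  shows "0 \<in> interior K"
proof -
  obtain x where x: "x \<in> interior K"
    using assms by (auto simp: symmetric_convex_body_def)
  have "uminus ` K = K"
    using assms by (force simp: symmetric_convex_body_def image_iff)
  then have "uminus ` interior K = interior K"
    by (metis interior_negations)
  then have "- x \<in> interior K" using x by blast
  moreover have "convex (interior K)"
    using assms by (simp add: symmetric_convex_body_def)
  ultimately have "(1/2) *\<^sub>R x + (1/2) *\<^sub>R (- x) \<in> interior K"
    using x convexD[of "interior K" x "- x" "1/2" "1/2"] by simp
  then show ?thesis by simp
qed

lemma convex_dist_least: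
  assumes "symmetric_convex_body K"
  shows "0 \<le> convex_dist K p q"
    and "q \<in> (\<lambda>x. p + convex_dist K p q *\<^sub>R x) ` K"
    and "\<And>s. 0 \<le> s \<Longrightarrow> q \<in> (\<lambda>x. p + s *\<^sub>R x) ` K \<Longrightarrow> convex_dist K p q \<le> s"
proof -
  let ?P = "\<lambda>s. 0 \<le> s \<and> q \<in> (\<lambda>x. p + s *\<^sub>R x) ` K"
  obtain e where e: "e > 0" "ball 0 e \<subseteq> K"
    using symmetric_convex_body_zero_interior[OF assms] by (auto simp: mem_interior)
  define M where "M = 2 * (norm (q - p) + 1) / e"
  have M: "M > 0" using e by (simp add: M_def add_nonneg_pos)
  have "norm ((1 / M) *\<^sub>R (q - p)) = norm (q - p) / M"
    unfolding norm_scaleR using M by simp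
  also have "norm (q - p) < e * M"
    unfolding M_def using e norm_ge_zero[of "q - p"] by (simp del: norm_ge_zero)
  then have "norm (q - p) / M < e"
    using M by (simp add: pos_divide_less_eq)
  finally have inK: "(1 / M) *\<^sub>R (q - p) \<in> K"
    using e by (auto simp: subset_iff)
  have PM: "?P M"
    using inK M by (intro conjI image_eqI[where x = "(1 / M) *\<^sub>R (q - p)"]) auto
  define C where "C = ({0..M} \<times> K) \<inter> {z. p + fst z *\<^sub>R snd z = q}"
  have "compact ({0..M} \<times> K)"
    using assms by (intro compact_Times) (auto simp: symmetric_convex_body_def)
  moreover have "closed {z::real \<times> (real ^ 2). p + fst z *\<^sub>R snd z = q}"
    by (intro closed_Collect_eq continuous_intros)
  ultimately have "compact C"
    unfolding C_def by (rule compact_Int_closed)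
  then have "compact (fst ` C)"
    by (intro compact_continuous_image continuous_intros)
  moreover have C: "s \<in> fst ` C \<longleftrightarrow> ?P s \<and> s \<le> M" for s
  proof
    assume "s \<in> fst ` C"
    then obtain k where "0 \<le> s" "s \<le> M" "k \<in> K" "p + s *\<^sub>R k = q"
      by (auto simp: C_def)
    then show "?P s \<and> s \<le> M" by blast
  next
    assume *: "?P s \<and> s \<le> M"
    then obtain k where "k \<in> K" "q = p + s *\<^sub>R k" by blast
    with * have "(s, k) \<in> C" by (simp add: C_def)
    then show "s \<in> fst ` C" by (metis fst_conv imageI)
  qed
  moreover have "fst ` C \<noteq> {}" using C PM by blast
  ultimately obtain m where m: "m \<in> fst ` C" "\<And>s. s \<in> fst ` C \<Longrightarrow> m \<le> s"
    using compact_attains_inf by metis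
  have Pm: "?P m" using m C by blast
  have le: "m \<le> s" if "?P s" for s
  proof (cases "s \<le> M")
    case True
    then show ?thesis using m(2) C that by blast
  next
    case False
    moreover have "m \<le> M" using m(1) C by blast
    ultimately show ?thesis by linarith
  qed
  have "convex_dist K p q = m"
    unfolding convex_dist_def using Pm le by (intro Least_equality) auto
  then show "0 \<le> convex_dist K p q" "q \<in> (\<lambda>x. p + convex_dist K p q *\<^sub>R x) ` K"
    "\<And>s. 0 \<le> s \<Longrightarrow> q \<in> (\<lambda>x. p + s *\<^sub>R x) ` K \<Longrightarrow> convex_dist K p q \<le> s"
    using Pm le by auto
qed

end

theory Submission
  imports Defs
begin

text \<open>
  Write \<open>d p q = N (q - p)\<close> for the norm \<open>N\<close> whose unit ball is the given body. Strict convexity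
  makes the triangle inequality strict for independent vectors, and the argument rests on this
  strictness.

  Suppose that an integral set \<open>S\<close> is infinite and not collinear. First, every line through two
  points of \<open>S\<close> contains only finitely many points of \<open>S\<close>: if \<open>q\<close> is on the line and \<open>r\<close> is not,
  then \<open>d x r - d x q\<close> is strictly monotone as \<open>x\<close> moves along a ray from \<open>q\<close>, but it is an integer
  of absolute value at most \<open>d q r\<close> (\<open>finite_integral_line\<close>).

  Now fix a triangle \<open>p, q, r\<close> in \<open>S\<close>. The differences \<open>d x p - d x r\<close> and \<open>d x q - d x r\<close> are
  integers bounded independently of \<open>x\<close>, so the pigeonhole principle gives three points of \<open>S\<close>,
  off the three lines of the triangle, with the same two differences. Give the sites \<open>p, q, r\<close>
  additive weights for which these three points are equidistant from all sites. Moving from such a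
  point straight towards a site makes this site strictly the nearest one
  (\<open>closer_along_segment\<close>). Hence segments from different points to different sites do not
  meet (\<open>segments_disjoint\<close>), and the nine segments draw the graph K(3,3) in the plane with
  straight edges and without crossings.

  Such a drawing is refuted by signs. In barycentric coordinates with respect
  to the triangle, a crossing is a sign condition on the minors of the coordinates of
  two points (\<open>segments_cross\<close>), and it turns out that of two points without crossings exactly one
  has a majority of positive coordinates (\<open>noncrossing_majority\<close>). This cannot hold for each two
  of three points.
\<close>

section \<open>Strictly convex norms\<close>

locale strictly_convex_norm =
  fixes N :: "'a::real_vector \<Rightarrow> real"
  assumes nonneg: "0 \<le> N v"
    and scale: "N (c *\<^sub>R v) = \<bar>c\<bar> * N v"
    and eq_0: "N v = 0 \<Longrightarrow> v = 0"
    and triangle: "N (u + v) \<le> N u + N v"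
    and strict: "u \<noteq> 0 \<Longrightarrow> v \<noteq> 0 \<Longrightarrow> N (u + v) = N u + N v \<Longrightarrow> \<exists>c>0. v = c *\<^sub>R u"
begin

lemma minus: "N (- v) = N v"
  using scale[of "-1" v] by simp

lemma minus_commute: "N (u - v) = N (v - u)"
  using minus[of "u - v"] by simp

lemma abs_diff_le: "\<bar>N (x - p) - N (x - q)\<bar> \<le> N (p - q)"
  using triangle[of "x - p" "p - q"] triangle[of "x - q" "q - p"] minus_commute[of p q]
  by simp

lemma strict_triangle:
  assumes "u \<noteq> 0" and "\<And>c. v \<noteq> c *\<^sub>R u"
  shows "N (u + v) < N u + N v"
proof -
  have "v \<noteq> 0" using assms(2)[of 0] by simp
  then have "N (u + v) \<noteq> N u + N v"
    using strict[of u v] assms by blast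
  then show ?thesis using triangle[of u v] by linarith
qed

text \<open>
  Going from the parameter \<open>s\<close> to \<open>t\<close> moves the point by \<open>(t - s) * N u\<close>. Its distance from \<open>r\<close>
  grows by strictly less, since \<open>r\<close> is not on the line.
\<close>

lemma ray_strict_decreasing:
  assumes "u \<noteq> 0" and off: "\<And>t. r \<noteq> q + t *\<^sub>R u" and "s < t"
  shows "N (q + t *\<^sub>R u - r) - t * N u < N (q + s *\<^sub>R u - r) - s * N u"
proof -
  have "q + s *\<^sub>R u - r \<noteq> c *\<^sub>R ((t - s) *\<^sub>R u)" for c
  proof
    assume "q + s *\<^sub>R u - r = c *\<^sub>R ((t - s) *\<^sub>R u)"
    then have "r = q + (s - c * (t - s)) *\<^sub>R u"
      by (simp add: algebra_simps)
    then show False using off by blast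
  qed
  then have "N ((t - s) *\<^sub>R u + (q + s *\<^sub>R u - r)) < N ((t - s) *\<^sub>R u) + N (q + s *\<^sub>R u - r)"
    using assms by (intro strict_triangle) auto
  moreover have "(t - s) *\<^sub>R u + (q + s *\<^sub>R u - r) = q + t *\<^sub>R u - r"
    by (simp add: algebra_simps)
  moreover have "N ((t - s) *\<^sub>R u) = (t - s) * N u" using \<open>s < t\<close> unfolding scale by simp
  ultimately show ?thesis by (simp add: left_diff_distrib)
qed

text \<open>
  For \<open>t \<ge> 0\<close> the number \<open>t * N u\<close> is the distance from \<open>q\<close>. So the strictly decreasing function is
  a difference of two integral distances, which takes finitely many values.
\<close>

lemma finite_integral_ray:
  assumes "u \<noteq> 0" and off: "\<And>t. r \<noteq> q + t *\<^sub>R u"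
    and "q \<in> S" "r \<in> S" and int: "\<And>x y. x \<in> S \<Longrightarrow> y \<in> S \<Longrightarrow> N (x - y) \<in> \<int>"
  shows "finite {t. 0 \<le> t \<and> q + t *\<^sub>R u \<in> S}" (is "finite ?T")
proof (rule finite_imageD)
  let ?f = "\<lambda>t. N (q + t *\<^sub>R u - r) - t * N u"
  show "inj_on ?f ?T"
  proof (rule inj_onI)
    fix s t assume "?f s = ?f t"
    then show "s = t"
      using ray_strict_decreasing[OF assms(1) off, of s t]
        ray_strict_decreasing[OF assms(1) off, of t s] by (cases s t rule: linorder_cases) auto
  qed
  have "?f ` ?T \<subseteq> {k \<in> \<int>. \<bar>k\<bar> \<le> N (r - q)}"
  proof
    fix k assume "k \<in> ?f ` ?T"
    then obtain t where t: "0 \<le> t" "q + t *\<^sub>R u \<in> S" "k = ?f t" by blast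
    define x where "x = q + t *\<^sub>R u"
    have "k = N (x - r) - N (x - q)"
      using t by (simp add: x_def scale)
    moreover have "x \<in> S" using t by (simp add: x_def)
    ultimately show "k \<in> {k \<in> \<int>. \<bar>k\<bar> \<le> N (r - q)}"
      using int abs_diff_le[of x r q] \<open>q \<in> S\<close> \<open>r \<in> S\<close> by simp
  qed
  then show "finite (?f ` ?T)"
    using finite_subset finite_abs_int_segment by blast
qed

lemma finite_integral_line:
  assumes "\<not> collinear {p, q, r}" "p \<in> S" "q \<in> S" "r \<in> S"
    and int: "\<And>x y. x \<in> S \<Longrightarrow> y \<in> S \<Longrightarrow> N (x - y) \<in> \<int>"
  shows "finite {x \<in> S. collinear {p, q, x}}"
proof -
  define u where "u = q - p"
  have "p \<noteq> q" using assms(1) by auto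
  then have "u \<noteq> 0" by (simp add: u_def)
  have on_line: "collinear {p, q, x} \<longleftrightarrow> (\<exists>t. x = p + t *\<^sub>R u)" for x
    using \<open>p \<noteq> q\<close> by (auto simp: collinear_3_affine_hull affine_hull_2_alt u_def)
  have off: "r \<noteq> p + t *\<^sub>R u" for t
    using assms(1) on_line[of r] by blast
  have off': "r \<noteq> p + t *\<^sub>R (- u)" for t
    using off[of "- t"] by simp
  let ?T = "\<lambda>v. {t. 0 \<le> t \<and> p + t *\<^sub>R v \<in> S}"
  have "finite (?T u)" "finite (?T (- u))"
    using finite_integral_ray[OF _ off] finite_integral_ray[OF _ off'] \<open>u \<noteq> 0\<close> assms by simp_all
  moreover have "{x \<in> S. collinear {p, q, x}} \<subseteq> (\<lambda>t. p + t *\<^sub>R u) ` ?T u \<union> (\<lambda>t. p + t *\<^sub>R (- u)) ` ?T (- u)"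
  proof
    fix x assume x: "x \<in> {x \<in> S. collinear {p, q, x}}"
    then obtain t where t: "x = p + t *\<^sub>R u" using on_line by blast
    show "x \<in> (\<lambda>t. p + t *\<^sub>R u) ` ?T u \<union> (\<lambda>t. p + t *\<^sub>R (- u)) ` ?T (- u)"
    proof (cases "0 \<le> t")
      case True
      then show ?thesis using x t by blast
    next
      case False
      then have "x = p + (- t) *\<^sub>R (- u)" "- t \<in> ?T (- u)" using x t by auto
      then show ?thesis by blast
    qed
  qed
  ultimately show ?thesis
    by (meson finite_UnI finite_imageI finite_subset)
qed

text \<open>
  The distance from \<open>p\<close> drops by exactly the length of the way from \<open>x\<close> to \<open>y\<close>; the distance from a
  site \<open>q\<close> in another direction drops by strictly less. In terms of weights for which \<open>x\<close> is
  equidistant from both sites: the half-open segment from \<open>x\<close> to \<open>p\<close> lies in the interior of the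
  weighted Voronoi cell of \<open>p\<close>.
\<close>

lemma closer_along_segment:
  assumes "\<not> collinear {x, p, q}" and s: "0 < s" "s \<le> 1"
  defines "y \<equiv> x + s *\<^sub>R (p - x)"
  shows "N (y - p) - N (x - p) < N (y - q) - N (x - q)"
proof -
  have "x \<noteq> p" using assms(1) by auto
  have "y - q \<noteq> c *\<^sub>R (s *\<^sub>R (x - p))" for c
  proof
    assume "y - q = c *\<^sub>R (s *\<^sub>R (x - p))"
    then have "q = (1 - s - c * s) *\<^sub>R x + (s + c * s) *\<^sub>R p"
      by (simp add: y_def algebra_simps)
    then have "collinear {x, q, p}"
      unfolding collinear_3_expand by (intro disjI2 exI[of _ "1 - s - c * s"]) simp
    then show False using assms(1) by (simp add: insert_commute)
  qed
  then have "N (s *\<^sub>R (x - p) + (y - q)) < N (s *\<^sub>R (x - p)) + N (y - q)"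
    using \<open>x \<noteq> p\<close> s by (intro strict_triangle) auto
  moreover have "s *\<^sub>R (x - p) + (y - q) = x - q"
    by (simp add: y_def algebra_simps)
  moreover have "N (y - p) = (1 - s) * N (x - p)"
  proof -
    have "y - p = (1 - s) *\<^sub>R (x - p)" by (simp add: y_def algebra_simps)
    then show ?thesis using s by (simp add: scale)
  qed
  moreover have "N (s *\<^sub>R (x - p)) = s * N (x - p)" using s unfolding scale by simp
  ultimately show ?thesis by (simp add: left_diff_distrib)
qed

text \<open>
  A common point of the two segments would lie in the weighted Voronoi cells of both sites, and in the
  interior of one of them unless it equals both \<open>x\<close> and \<open>x'\<close>.
\<close>

lemma segments_disjoint:
  assumes "\<not> collinear {x, p, q}" "\<not> collinear {x', p, q}" "x \<noteq> x'"
    and "N (x - p) - N (x - q) = N (x' - p) - N (x' - q)"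
    and st: "0 \<le> s" "s \<le> 1" "0 \<le> t" "t \<le> 1"
  shows "x + s *\<^sub>R (p - x) \<noteq> x' + t *\<^sub>R (q - x')"
proof
  define y where "y = x + s *\<^sub>R (p - x)"
  assume eq: "x + s *\<^sub>R (p - x) = x' + t *\<^sub>R (q - x')"
  have "N (y - p) - N (x - p) \<le> N (y - q) - N (x - q)"
    using closer_along_segment[of x p q s] assms by (cases "s = 0") (auto simp: y_def)
  moreover have "N (y - p) - N (x - p) < N (y - q) - N (x - q)" if "0 < s"
    using closer_along_segment[of x p q s] assms that by (auto simp: y_def)
  moreover have "N (y - q) - N (x' - q) \<le> N (y - p) - N (x' - p)"
    using closer_along_segment[of x' q p t] assms eq
    by (cases "t = 0") (auto simp: y_def insert_commute)
  moreover have "N (y - q) - N (x' - q) < N (y - p) - N (x' - p)" if "0 < t"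
    using closer_along_segment[of x' q p t] assms eq that by (auto simp: y_def insert_commute)
  ultimately have "s = 0" "t = 0" using assms by linarith+
  then show False using eq \<open>x \<noteq> x'\<close> by simp
qed

end

section \<open>The gauge of a strictly convex body\<close>

lemma convex_dist_translation: "convex_dist K p q = convex_dist K 0 (q - p)"
proof -
  have "q \<in> (\<lambda>x. p + s *\<^sub>R x) ` K \<longleftrightarrow> q - p \<in> (\<lambda>x. 0 + s *\<^sub>R x) ` K" for s
    by (force simp: image_iff algebra_simps)
  then show ?thesis by (simp add: convex_dist_def)
qed

lemma convex_dist_homothet_le:
  assumes "symmetric_convex_body K" "k \<in> K" "0 \<le> s"
  shows "convex_dist K 0 (s *\<^sub>R k) \<le> s"
  using convex_dist_least(3)[OF assms(1,3), of "s *\<^sub>R k" 0] assms by auto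

lemma gauge_representation:
  assumes "symmetric_convex_body K"
  obtains k where "k \<in> K" "v = convex_dist K 0 v *\<^sub>R k"
  using convex_dist_least(2)[OF assms, of v 0] by auto

lemma gauge_unit_imp_frontier:
  assumes K: "symmetric_convex_body K" and "x \<in> K" "1 \<le> convex_dist K 0 x"
  shows "x \<in> frontier K"
proof -
  have "x \<notin> interior K"
  proof
    assume "x \<in> interior K"
    then obtain e where e: "0 < e" "cball x e \<subseteq> K" by (auto simp: mem_interior_cball)
    \<comment> \<open>Stretching \<open>x\<close> by \<open>1 + \<delta>\<close> moves it by at most \<open>e\<close> and so stays inside the body.\<close>
    define \<delta> where "\<delta> = e / (norm x + 1)"
    have n: "0 < norm x + 1" by (simp add: add_nonneg_pos)
    then have \<delta>: "0 < \<delta>" using e by (simp add: \<delta>_def)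
    have "dist x ((1 + \<delta>) *\<^sub>R x) = \<delta> * norm x"
      using \<delta> by (simp add: dist_norm algebra_simps)
    also have "\<dots> \<le> e"
      using e n by (simp add: \<delta>_def field_simps)
    finally have "(1 + \<delta>) *\<^sub>R x \<in> K" using e by (auto simp: subset_iff)
    then have "convex_dist K 0 ((1 / (1 + \<delta>)) *\<^sub>R ((1 + \<delta>) *\<^sub>R x)) \<le> 1 / (1 + \<delta>)"
      using \<delta> K by (intro convex_dist_homothet_le) auto
    then have "convex_dist K 0 x \<le> 1 / (1 + \<delta>)" using \<delta> by simp
    moreover have "1 / (1 + \<delta>) < 1" using \<delta> by simp
    ultimately show False using assms by linarith
  qed
  then show ?thesis using \<open>x \<in> K\<close> closure_subset by (auto simp: frontier_def)
qed

lemma gauge_scale: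
  assumes K: "symmetric_convex_body K"
  shows "convex_dist K 0 (c *\<^sub>R v) = \<bar>c\<bar> * convex_dist K 0 v"
proof -
  let ?N = "convex_dist K 0"
  have le: "?N (c *\<^sub>R v) \<le> \<bar>c\<bar> * ?N v" for c v
  proof -
    obtain k where k: "k \<in> K" "v = ?N v *\<^sub>R k" using gauge_representation[OF K] .
    have "sgn c *\<^sub>R k \<in> K \<or> c = 0"
      using k K by (cases c "0::real" rule: linorder_cases) (auto simp: symmetric_convex_body_def)
    moreover have "(\<bar>c\<bar> * ?N v) *\<^sub>R (sgn c *\<^sub>R k) = c *\<^sub>R v"
      using k(2) by (metis (no_types, opaque_lifting) mult.commute mult_sgn_abs scaleR_scaleR)
    moreover have "0 \<le> \<bar>c\<bar> * ?N v" using convex_dist_least(1)[OF K] by simp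
    ultimately show ?thesis
      using convex_dist_homothet_le[OF K, of "sgn c *\<^sub>R k" "\<bar>c\<bar> * ?N v"]
        convex_dist_homothet_le[OF K, of k 0] k by auto
  qed
  show ?thesis
  proof (cases "c = 0")
    case True
    then show ?thesis using le[of 0 v] convex_dist_least(1)[OF K, of 0 0] by simp
  next
    case False
    have "?N ((1 / c) *\<^sub>R (c *\<^sub>R v)) \<le> \<bar>1 / c\<bar> * ?N (c *\<^sub>R v)" by (rule le)
    then have "\<bar>c\<bar> * ?N v \<le> ?N (c *\<^sub>R v)" using False by (simp add: field_simps)
    then show ?thesis using le[of c v] by linarith
  qed
qed

text \<open>
  With \<open>u\<close> and \<open>v\<close> written as multiples of points \<open>k\<close> and \<open>l\<close> of the body, \<open>u + v\<close> is a multiple of a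
  convex combination of \<open>k\<close> and \<open>l\<close>.
\<close>

lemma gauge_triangle:
  assumes K: "symmetric_convex_body K"
  shows "convex_dist K 0 (u + v) \<le> convex_dist K 0 u + convex_dist K 0 v"
proof -
  let ?N = "convex_dist K 0"
  obtain k l where k: "k \<in> K" "u = ?N u *\<^sub>R k" and l: "l \<in> K" "v = ?N v *\<^sub>R l"
    using gauge_representation[OF K] by metis
  have nn: "0 \<le> ?N u" "0 \<le> ?N v" using convex_dist_least(1)[OF K] by auto
  show ?thesis
  proof (cases "?N u + ?N v = 0")
    case True
    then have "u = 0" "v = 0" using k l nn by (auto simp: add_nonneg_eq_0_iff)
    then show ?thesis using nn by simp
  next
    case False
    then have pos: "0 < ?N u + ?N v" using nn by linarith
    define m where "m = (?N u / (?N u + ?N v)) *\<^sub>R k + (?N v / (?N u + ?N v)) *\<^sub>R l"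
    have "m \<in> K"
      unfolding m_def
      by (rule convexD) (use K k(1) l(1) nn pos in
        \<open>simp_all add: symmetric_convex_body_def flip: add_divide_distrib\<close>)
    moreover have "(?N u + ?N v) *\<^sub>R m = u + v"
      using k(2) l(2) False by (simp add: m_def scaleR_add_right)
    ultimately show ?thesis
      using convex_dist_homothet_le[OF K, of m "?N u + ?N v"] pos by simp
  qed
qed

text \<open>
  Let \<open>k\<close> and \<open>l\<close> be the normalizations of \<open>u\<close> and \<open>v\<close>. Equality in the triangle inequality means that
  some inner point of the segment from \<open>k\<close> to \<open>l\<close> has gauge 1. The gauge is convex and at most 1 on
  this segment, so it is constantly 1 there. The segment then lies in the frontier, hence is
  degenerate.
\<close>

lemma gauge_strict:
  assumes K: "symmetric_convex_body K" and strict: "strictly_convex_body K"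
    and "u \<noteq> 0" "v \<noteq> 0"
    and eq: "convex_dist K 0 (u + v) = convex_dist K 0 u + convex_dist K 0 v"
  shows "\<exists>c>0. v = c *\<^sub>R u"
proof -
  let ?N = "convex_dist K 0"
  obtain k l where k: "k \<in> K" "u = ?N u *\<^sub>R k" and l: "l \<in> K" "v = ?N v *\<^sub>R l"
    using gauge_representation[OF K] by metis
  have "?N u \<noteq> 0" "?N v \<noteq> 0"
    using k(2) l(2) assms(3,4) by auto
  then have pos: "0 < ?N u" "0 < ?N v"
    using convex_dist_least(1)[OF K] by (simp_all add: less_le)
  have le1: "?N x \<le> 1" if "x \<in> K" for x
    using convex_dist_homothet_le[OF K that, of 1] by simp
  define x where "x t = (1 - t) *\<^sub>R k + t *\<^sub>R l" for t
  define \<mu> where "\<mu> = ?N v / (?N u + ?N v)"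
  have \<mu>: "0 < \<mu>" "\<mu> < 1" using pos by (simp_all add: \<mu>_def)
  have "(?N u + ?N v) *\<^sub>R x \<mu> = u + v"
  proof -
    have "(?N u + ?N v) * \<mu> = ?N v" using pos by (simp add: \<mu>_def)
    then have "(?N u + ?N v) *\<^sub>R x \<mu> = ?N u *\<^sub>R k + ?N v *\<^sub>R l"
      by (simp add: x_def scaleR_add_right right_diff_distrib)
    then show ?thesis using k l by simp
  qed
  then have "(?N u + ?N v) * ?N (x \<mu>) = ?N u + ?N v"
    using gauge_scale[OF K, of "?N u + ?N v" "x \<mu>"] eq pos by simp
  then have mid: "?N (x \<mu>) = 1" using pos by simp
  have x_K: "x t \<in> K" if "0 \<le> t" "t \<le> 1" for t
    using K k(1) l(1) that by (auto simp: x_def symmetric_convex_body_def intro!: convexD)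
  have "x t \<in> frontier K" if t: "0 \<le> t" "t \<le> 1" for t
  proof -
    \<comment> \<open>\<open>s\<close> is a parameter beyond \<open>\<mu>\<close>, seen from \<open>t\<close>; a value below 1 at \<open>t\<close> would
       need a value above 1 at \<open>s\<close>.\<close>
    define \<delta> where "\<delta> = min \<mu> (1 - \<mu>)"
    have \<delta>: "0 < \<delta>" "\<delta> \<le> \<mu>" "\<delta> \<le> 1 - \<mu>" using \<mu> by (auto simp: \<delta>_def)
    define s where "s = \<mu> + \<delta> * (\<mu> - t)"
    have "\<delta> * (\<mu> - t) \<le> \<delta>" "- \<delta> \<le> \<delta> * (\<mu> - t)"
      using \<delta> \<mu> t mult_left_mono[of "\<mu> - t" 1 \<delta>] mult_left_mono[of "-1" "\<mu> - t" \<delta>] by simp_all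
    then have "0 \<le> s" "s \<le> 1" unfolding s_def using \<delta> by linarith+
    then have "?N (x s) \<le> 1" using le1 x_K by blast
    moreover have "(1 + \<delta>) *\<^sub>R x \<mu> = x s + \<delta> *\<^sub>R x t"
      by (simp add: x_def s_def algebra_simps)
    then have "(1 + \<delta>) * ?N (x \<mu>) \<le> ?N (x s) + \<delta> * ?N (x t)"
      using gauge_scale[OF K, of "1 + \<delta>" "x \<mu>"] gauge_scale[OF K, of \<delta> "x t"]
        gauge_triangle[OF K, of "x s" "\<delta> *\<^sub>R x t"] \<delta> by simp
    ultimately have "\<delta> * 1 \<le> \<delta> * ?N (x t)" using mid by simp
    then have "1 \<le> ?N (x t)" using \<delta> by simp
    then show ?thesis using gauge_unit_imp_frontier[OF K x_K[OF t]] by blast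
  qed
  then have "closed_segment k l \<subseteq> frontier K"
    by (auto simp: closed_segment_def x_def)
  then have "k = l" using strict by (auto simp: strictly_convex_body_def)
  then have "v = (?N v / ?N u) *\<^sub>R u"
    using k(2) l(2) pos by (metis (no_types, opaque_lifting) less_irrefl nonzero_eq_divide_eq scaleR_scaleR)
  then show ?thesis using pos by (intro exI[of _ "?N v / ?N u"]) simp
qed

lemma gauge_strictly_convex_norm:
  assumes K: "symmetric_convex_body K" and "strictly_convex_body K"
  shows "strictly_convex_norm (convex_dist K 0)"
proof
  show "v = 0" if "convex_dist K 0 v = 0" for v
    using gauge_representation[OF K, of v] that by auto
qed (use assms convex_dist_least(1) gauge_scale gauge_triangle gauge_strict in auto)

section \<open>Crossing segments in barycentric coordinates\<close>

text \<open>
  At a common point of the segments from \<open>x\<close> to \<open>p\<close> and from \<open>x'\<close> to \<open>q\<close>, comparing coefficients of \<open>r\<close>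
  shows that the weights of \<open>x\<close> and \<open>x'\<close> are proportional to \<open>c'\<close> and \<open>c\<close>. The other two coefficients
  give the weights \<open>c' / e\<close> and \<open>c / e\<close> with the number \<open>e\<close> below, and the two minors divided by \<open>e\<close>
  are the remaining weights of \<open>q\<close> and \<open>p\<close>. The sign hypotheses say that all these weights are
  nonnegative.
\<close>

lemma segments_cross:
  fixes p q r :: "'a::real_vector"
  assumes "x = a *\<^sub>R p + b *\<^sub>R q + c *\<^sub>R r" "a + b + c = 1"
    and "x' = a' *\<^sub>R p + b' *\<^sub>R q + c' *\<^sub>R r" "a' + b' + c' = 1"
    and "0 < c * c'" "0 \<le> c * (b * c' - b' * c)" "0 \<le> c * (c * a' - c' * a)"
  shows "\<exists>s t. 0 \<le> s \<and> s \<le> 1 \<and> 0 \<le> t \<and> t \<le> 1 \<and> x + s *\<^sub>R (p - x) = x' + t *\<^sub>R (q - x')"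
proof -
  define e where "e = c + (b * c' - b' * c)"
  have b: "b = 1 - a - c" and b': "b' = 1 - a' - c'" using assms by auto
  have e': "e = c' + (c * a' - c' * a)"
    by (simp add: e_def b b' algebra_simps)
  have "c \<noteq> 0" using assms(5) by auto
  then have "0 < c * c" by (auto simp: zero_less_mult_iff)
  then have "0 < c * e" using assms(6) by (simp add: e_def distrib_left)
  then consider "0 < c" "0 < e" | "c < 0" "e < 0" by (auto simp: zero_less_mult_iff)
  then have bounds: "0 \<le> 1 - c' / e" "1 - c' / e \<le> 1" "0 \<le> 1 - c / e" "1 - c / e \<le> 1" and "e \<noteq> 0"
    using assms(5-7) unfolding atomize_conj
    by cases (auto simp: divide_simps zero_less_mult_iff zero_le_mult_iff e_def, auto simp: e' simp flip: e_def)
  have "e *\<^sub>R (x + (1 - c' / e) *\<^sub>R (p - x)) = (e - c') *\<^sub>R p + c' *\<^sub>R x"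
    using \<open>e \<noteq> 0\<close> by (simp add: algebra_simps)
  also have "\<dots> = (e - c' + c' * a) *\<^sub>R p + (c' * b) *\<^sub>R q + (c' * c) *\<^sub>R r"
    by (simp add: assms(1) algebra_simps)
  also have "\<dots> = (c * a') *\<^sub>R p + (e - c + c * b') *\<^sub>R q + (c * c') *\<^sub>R r"
    by (simp add: e' b b' algebra_simps)
  also have "\<dots> = (e - c) *\<^sub>R q + c *\<^sub>R x'"
    by (simp add: assms(3) algebra_simps)
  also have "\<dots> = e *\<^sub>R (x' + (1 - c / e) *\<^sub>R (q - x'))"
    using \<open>e \<noteq> 0\<close> by (simp add: algebra_simps)
  finally have "x + (1 - c' / e) *\<^sub>R (p - x) = x' + (1 - c / e) *\<^sub>R (q - x')"
    using \<open>e \<noteq> 0\<close> by simp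
  then show ?thesis using bounds by blast
qed

text \<open>
  The minors change sign when \<open>x\<close> and \<open>x'\<close> are exchanged. So if the product of the two minors is
  nonnegative, their common sign decides which of the two pairs of segments crosses.
\<close>

lemma disjoint_segments_sign:
  fixes p q r :: "'a::real_vector"
  assumes "x = a *\<^sub>R p + b *\<^sub>R q + c *\<^sub>R r" "a + b + c = 1"
    and "x' = a' *\<^sub>R p + b' *\<^sub>R q + c' *\<^sub>R r" "a' + b' + c' = 1"
    and pq: "\<And>s t. 0 \<le> s \<Longrightarrow> s \<le> 1 \<Longrightarrow> 0 \<le> t \<Longrightarrow> t \<le> 1 \<Longrightarrow>
      x + s *\<^sub>R (p - x) \<noteq> x' + t *\<^sub>R (q - x')"
    and qp: "\<And>s t. 0 \<le> s \<Longrightarrow> s \<le> 1 \<Longrightarrow> 0 \<le> t \<Longrightarrow> t \<le> 1 \<Longrightarrow>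
      x' + s *\<^sub>R (p - x') \<noteq> x + t *\<^sub>R (q - x)"
    and "0 < c * c'"
  shows "(b * c' - b' * c) * (c * a' - c' * a) < 0"
proof (rule ccontr)
  assume "\<not> ?thesis"
  then have "0 \<le> (b * c' - b' * c) * (c * a' - c' * a)" by simp
  then consider "0 \<le> c * (b * c' - b' * c)" "0 \<le> c * (c * a' - c' * a)"
    | "0 \<le> c' * (b' * c - b * c')" "0 \<le> c' * (c' * a - c * a')"
    using \<open>0 < c * c'\<close> by (auto simp: zero_le_mult_iff zero_less_mult_iff)
  then show False
  proof cases
    case 1
    from segments_cross[OF assms(1-4) \<open>0 < c * c'\<close> 1] show False using pq by blast
  next
    case 2
    from segments_cross[OF assms(3,4,1,2) _ 2] \<open>0 < c * c'\<close> show False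
      using qp by (auto simp: mult.commute)
  qed
qed

text \<open>
  Suppose that two points agree in the sign of their first coordinate, and that for each of them some
  further coordinate has this sign too; then some segments cross. Divide by the first coordinates to get
  the pairs \<open>(B, C)\<close> and \<open>(B', C')\<close>, each with a positive entry. The first noncrossing condition orders
  them strictly and in the same direction, say \<open>B' < B\<close> and \<open>C' < C\<close>. If, say, \<open>B' > 0\<close>, then
  \<open>B > 0\<close> as well and the second condition gives \<open>B' * C < B * C'\<close>. This contradicts the third
  condition if \<open>C' > 0\<close>, and it contradicts the order if \<open>C' \<le> 0\<close>.
\<close>

lemma shared_majority_sign_crossing:
  fixes a b c a' b' c' :: real
  assumes "0 < a * a'" "0 < a * b \<or> 0 < a * c" "0 < a' * b' \<or> 0 < a' * c'"
    and "(c * a' - c' * a) * (a * b' - a' * b) < 0"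
    and "0 < b * b' \<Longrightarrow> (a * b' - a' * b) * (b * c' - b' * c) < 0"
    and "0 < c * c' \<Longrightarrow> (b * c' - b' * c) * (c * a' - c' * a) < 0"
  shows False
proof -
  have core: False
    if "b' < b" "c' < c" "0 < b'"
      and "0 < b * b' \<Longrightarrow> (b' - b) * (b * c' - b' * c) < 0"
      and "0 < c * c' \<Longrightarrow> (b * c' - b' * c) * (c - c') < 0"
    for b b' c c' :: real
  proof -
    have "0 < b * c' - b' * c" using that by (auto simp: mult_less_0_iff)
    moreover from this have "\<not> 0 < c * c'" using that by (auto simp: mult_less_0_iff)
    then have "c' \<le> 0" using that by (auto simp: zero_less_mult_iff)
    then have "b * c' \<le> b' * c'" using that by (simp add: mult_right_mono_neg)
    moreover have "b' * c' < b' * c" using that by simp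
    ultimately show False by linarith
  qed
  have core2: False
    if "b' < b" "c' < c" "0 < b' \<or> 0 < c'"
      and "0 < b * b' \<Longrightarrow> (b' - b) * (b * c' - b' * c) < 0"
      and "0 < c * c' \<Longrightarrow> (b * c' - b' * c) * (c - c') < 0"
    for b b' c c' :: real
    using that core[of b' b c' c] core[of c' c b' b] by (auto simp: mult_less_0_iff mult.commute)
  define B B' C C' where "B = b / a" and "B' = b' / a'" and "C = c / a" and "C' = c' / a'"
  have nz: "a \<noteq> 0" "a' \<noteq> 0" using assms(1) by auto
  have eqs: "b = a * B" "b' = a' * B'" "c = a * C" "c' = a' * C'"
    using nz by (simp_all add: B_def B'_def C_def C'_def)
  have minors: "c * a' - c' * a = (a * a') * (C - C')" "a * b' - a' * b = (a * a') * (B' - B)"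
    "b * c' - b' * c = (a * a') * (B * C' - B' * C)"
    "b * b' = (a * a') * (B * B')" "c * c' = (a * a') * (C * C')"
    by (simp_all add: eqs algebra_simps)
  have cancel: "(a * a') * u * ((a * a') * v) < 0 \<longleftrightarrow> u * v < 0" "0 < (a * a') * u \<longleftrightarrow> 0 < u" for u v
    using assms(1) by (auto simp: mult_less_0_iff zero_less_mult_iff)
  have ord: "(C - C') * (B' - B) < 0"
    and bb: "0 < B * B' \<Longrightarrow> (B' - B) * (B * C' - B' * C) < 0"
    and cc: "0 < C * C' \<Longrightarrow> (B * C' - B' * C) * (C - C') < 0"
    using assms(4-6) unfolding minors cancel by blast+
  have pos: "0 < B \<or> 0 < C" "0 < B' \<or> 0 < C'"
  proof -
    have "0 < a * (a * u) \<longleftrightarrow> 0 < u" "0 < a' * (a' * u) \<longleftrightarrow> 0 < u" for u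
      using nz by (auto simp: zero_less_mult_iff mult_less_0_iff)
    then show "0 < B \<or> 0 < C" "0 < B' \<or> 0 < C'"
      using assms(2,3) unfolding eqs by blast+
  qed
  from ord consider "B' < B" "C' < C" | "B < B'" "C < C'"
    by (auto simp: mult_less_0_iff)
  then show False
  proof cases
    case 1
    then show False using core2[of B' B C' C] bb cc pos by blast
  next
    case 2
    then show False using core2[of B B' C C'] bb cc pos
      by (auto simp: mult.commute mult_less_0_iff)
  qed
qed

text \<open>
  For nonzero barycentric coordinates, the complement of the three lines of the triangle has seven
  regions. The mostly positive ones are the triangle and the regions across an edge; the others are
  the regions behind a vertex.
\<close>

definition mostly_positive :: "real \<Rightarrow> real \<Rightarrow> real \<Rightarrow> bool" where
  "mostly_positive a b c \<longleftrightarrow> 0 < a \<and> 0 < b \<or> 0 < b \<and> 0 < c \<or> 0 < c \<and> 0 < a"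

text \<open>
  If both points have the same majority sign, then each has this sign in at least two of three
  coordinates, so they share a coordinate to which \<open>shared_majority_sign_crossing\<close> applies.
\<close>

lemma noncrossing_majority:
  fixes a b c a' b' c' :: real
  assumes nz: "a \<noteq> 0" "b \<noteq> 0" "c \<noteq> 0" "a' \<noteq> 0" "b' \<noteq> 0" "c' \<noteq> 0"
    and A: "0 < a * a' \<Longrightarrow> (c * a' - c' * a) * (a * b' - a' * b) < 0"
    and B: "0 < b * b' \<Longrightarrow> (a * b' - a' * b) * (b * c' - b' * c) < 0"
    and C: "0 < c * c' \<Longrightarrow> (b * c' - b' * c) * (c * a' - c' * a) < 0"
  shows "mostly_positive a b c \<noteq> mostly_positive a' b' c'"
proof
  assume "mostly_positive a b c = mostly_positive a' b' c'"
  moreover have "0 < u * v \<longleftrightarrow> (0 < u \<longleftrightarrow> 0 < v)" if "u \<noteq> 0" "v \<noteq> 0" for u v :: real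
    using that by (auto simp: zero_less_mult_iff)
  ultimately consider "0 < a * a'" "0 < a * b \<or> 0 < a * c" "0 < a' * b' \<or> 0 < a' * c'"
    | "0 < b * b'" "0 < b * c \<or> 0 < b * a" "0 < b' * c' \<or> 0 < b' * a'"
    | "0 < c * c'" "0 < c * a \<or> 0 < c * b" "0 < c' * a' \<or> 0 < c' * b'"
    using nz unfolding mostly_positive_def by metis
  then show False
  proof cases
    case 1
    then show ?thesis using shared_majority_sign_crossing[OF 1] A B C by blast
  next
    case 2
    then show ?thesis using shared_majority_sign_crossing[OF 2] A B C by blast
  next
    case 3
    then show ?thesis using shared_majority_sign_crossing[OF 3] A B C by blast
  qed
qed

lemma barycentric_coordinates:
  fixes p q r x :: "real ^ 2"
  assumes "\<not> collinear {p, q, r}"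
  obtains a b c where "x = a *\<^sub>R p + b *\<^sub>R q + c *\<^sub>R r" "a + b + c = 1"
proof -
  have "\<not> affine_dependent {p, q, r}" "card {p, q, r} = 3"
    using assms by (auto simp: collinear_3_eq_affine_dependent)
  then have "affine hull {p, q, r} = UNIV"
    by (intro affine_independent_span_eq) auto
  then have "x \<in> affine hull {p, q, r}" by simp
  then show ?thesis using that unfolding affine_hull_3 by blast
qed

lemma barycentric_coordinate_nonzero:
  assumes "x = a *\<^sub>R p + b *\<^sub>R q + c *\<^sub>R r" "a + b + c = 1"
    and "\<not> collinear {x, q, r}"
  shows "a \<noteq> 0"
proof
  assume "a = 0"
  then have "c = 1 - b" using assms(2) by simp
  then have "x = b *\<^sub>R q + (1 - b) *\<^sub>R r" using assms(1) \<open>a = 0\<close> by simp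
  then have "collinear {q, x, r}" unfolding collinear_3_expand by blast
  then show False using assms(3) by (simp add: insert_commute)
qed

section \<open>Integral distance sets\<close>

lemma (in strictly_convex_norm) equidistant_mostly_positive:
  fixes p q r x x' :: 'a
  assumes "x = a *\<^sub>R p + b *\<^sub>R q + c *\<^sub>R r" "a + b + c = 1"
    and "x' = a' *\<^sub>R p + b' *\<^sub>R q + c' *\<^sub>R r" "a' + b' + c' = 1"
    and "\<not> collinear {x, p, q}" "\<not> collinear {x, q, r}" "\<not> collinear {x, r, p}"
    and "\<not> collinear {x', p, q}" "\<not> collinear {x', q, r}" "\<not> collinear {x', r, p}"
    and "x \<noteq> x'"
    and "N (x - p) - N (x - r) = N (x' - p) - N (x' - r)"
    and "N (x - q) - N (x - r) = N (x' - q) - N (x' - r)"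
  shows "mostly_positive a b c \<noteq> mostly_positive a' b' c'"
proof -
  have x: "x = b *\<^sub>R q + c *\<^sub>R r + a *\<^sub>R p" "b + c + a = 1" "x = c *\<^sub>R r + a *\<^sub>R p + b *\<^sub>R q" "c + a + b = 1"
    and x': "x' = b' *\<^sub>R q + c' *\<^sub>R r + a' *\<^sub>R p" "b' + c' + a' = 1"
      "x' = c' *\<^sub>R r + a' *\<^sub>R p + b' *\<^sub>R q" "c' + a' + b' = 1"
    using assms by (simp_all add: ac_simps)
  have disj: "u + s *\<^sub>R (y - u) \<noteq> v + t *\<^sub>R (z - v)"
    if "0 \<le> s" "s \<le> 1" "0 \<le> t" "t \<le> 1" "u = x \<and> v = x' \<or> u = x' \<and> v = x"
      "y = p \<and> z = q \<or> y = q \<and> z = r \<or> y = r \<and> z = p" for u v y z s t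
    by (rule segments_disjoint) (use that assms in auto)
  have C: "(b * c' - b' * c) * (c * a' - c' * a) < 0" if "0 < c * c'"
    by (rule disjoint_segments_sign[OF assms(1-4) _ _ that]) (simp_all add: disj)
  have A: "(c * a' - c' * a) * (a * b' - a' * b) < 0" if "0 < a * a'"
    by (rule disjoint_segments_sign[OF x(1,2) x'(1,2) _ _ that]) (simp_all add: disj)
  have B: "(a * b' - a' * b) * (b * c' - b' * c) < 0" if "0 < b * b'"
    by (rule disjoint_segments_sign[OF x(3,4) x'(3,4) _ _ that]) (simp_all add: disj)
  have "a \<noteq> 0" "b \<noteq> 0" "c \<noteq> 0" "a' \<noteq> 0" "b' \<noteq> 0" "c' \<noteq> 0"
    using barycentric_coordinate_nonzero[OF assms(1,2,6)] barycentric_coordinate_nonzero[OF x(1,2) assms(7)]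
      barycentric_coordinate_nonzero[OF x(3,4) assms(5)] barycentric_coordinate_nonzero[OF assms(3,4,9)]
      barycentric_coordinate_nonzero[OF x'(1,2) assms(10)] barycentric_coordinate_nonzero[OF x'(3,4) assms(8)]
    by blast+
  then show ?thesis by (rule noncrossing_majority) (fact A B C)+
qed

lemma integral_set_finite_or_collinear:
  fixes N :: "real ^ 2 \<Rightarrow> real"
  assumes "strictly_convex_norm N" and int: "\<And>x y. x \<in> S \<Longrightarrow> y \<in> S \<Longrightarrow> N (x - y) \<in> \<int>"
  shows "finite S \<or> collinear S"
proof (rule ccontr)
  interpret strictly_convex_norm N by fact
  assume "\<not> ?thesis"
  then have inf: "infinite S" and noncol: "\<not> collinear S" by auto
  obtain p where p: "p \<in> S" using inf by fastforce
  have "infinite (S - {p})" using inf by simp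
  then obtain q where q: "q \<in> S" "q \<noteq> p" by (metis DiffE finite.emptyI insertI1 ex_in_conv)
  have "insert p (insert q S) = S" using p q by auto
  then obtain r where r: "r \<in> S" and pqr: "\<not> collinear {p, q, r}"
    using collinear_triples[of p q S] noncol q by auto
  \<comment> \<open>Off the lines of the triangle, barycentric coordinates are nonzero and the triangle inequalities
     are strict.\<close>
  define T where "T = S - ({x \<in> S. collinear {p, q, x}} \<union> {x \<in> S. collinear {q, r, x}}
    \<union> {x \<in> S. collinear {r, p, x}})"
  have "finite {x \<in> S. collinear {p, q, x}}" "finite {x \<in> S. collinear {q, r, x}}"
    "finite {x \<in> S. collinear {r, p, x}}"
    using finite_integral_line[of p q r S] finite_integral_line[of q r p S]
      finite_integral_line[of r p q S] pqr p q r int by (simp_all add: insert_commute)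
  then have "infinite T" using inf unfolding T_def by (intro Diff_infinite_finite) auto
  define f where "f x = (N (x - p) - N (x - r), N (x - q) - N (x - r))" for x
  have "f ` T \<subseteq> {k \<in> \<int>. \<bar>k\<bar> \<le> N (p - r)} \<times> {k \<in> \<int>. \<bar>k\<bar> \<le> N (q - r)}"
    using int abs_diff_le p q r by (auto simp: f_def T_def)
  then have "finite (f ` T)"
    by (rule finite_subset) (intro finite_cartesian_product finite_abs_int_segment)
  then obtain z where "infinite {x \<in> T. f x = f z}"
    using pigeonhole_infinite[OF \<open>infinite T\<close>] by blast
  then obtain X where X: "card X = 3" "X \<subseteq> {x \<in> T. f x = f z}"
    using infinite_arbitrarily_large by blast
  then obtain x y w where xyw: "X = {x, y, w}" "x \<noteq> y" "x \<noteq> w" "y \<noteq> w"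
    by (auto simp: card_3_iff)
  have bary: "\<exists>a b c. v = a *\<^sub>R p + b *\<^sub>R q + c *\<^sub>R r \<and> a + b + c = 1" for v
    using barycentric_coordinates[OF pqr] by metis
  then obtain a b c where abc: "\<And>v. v = a v *\<^sub>R p + b v *\<^sub>R q + c v *\<^sub>R r" "\<And>v. a v + b v + c v = 1"
    by metis
  have "mostly_positive (a u) (b u) (c u) \<noteq> mostly_positive (a v) (b v) (c v)"
    if "u \<in> X" "v \<in> X" "u \<noteq> v" for u v
  proof (rule equidistant_mostly_positive[OF abc abc])
    have "u \<in> T" "v \<in> T" and "f u = f z" "f v = f z" using that X by auto
    then show "\<not> collinear {u, p, q}" "\<not> collinear {u, q, r}" "\<not> collinear {u, r, p}"
      "\<not> collinear {v, p, q}" "\<not> collinear {v, q, r}" "\<not> collinear {v, r, p}"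
      by (auto simp: T_def insert_commute)
    show "N (u - p) - N (u - r) = N (v - p) - N (v - r)"
      "N (u - q) - N (u - r) = N (v - q) - N (v - r)"
      using \<open>f u = f z\<close> \<open>f v = f z\<close> by (auto simp: f_def)
  qed fact
  then show False using xyw by (metis insertCI)
qed

theorem theorem2:
  fixes d :: "real ^ 2 \<Rightarrow> real ^ 2 \<Rightarrow> real"
    and S :: "(real ^ 2) set"
  assumes "strictly_convex_distance d"
    and "\<forall>p\<in>S. \<forall>q\<in>S. d p q \<in> \<int>"
  shows "finite S \<or> collinear S"
proof -
  obtain K where K: "symmetric_convex_body K" "strictly_convex_body K" and d: "d = convex_dist K"
    using assms(1) by (auto simp: strictly_convex_distance_def)
  have "convex_dist K 0 (x - y) \<in> \<int>" if "x \<in> S" "y \<in> S" for x y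
    using assms(2) that convex_dist_translation[of K y x] unfolding d by metis
  then show ?thesis
    using integral_set_finite_or_collinear gauge_strictly_convex_norm[OF K] by blast
qed

end
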